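(* Let $v$ be a valuation on $\tilde R[y;\delta]$ with residue field $\mathbb{R}$. Then the value group of $v$ is not of rational rank one.
   Context: A valuation on a division ring $D$ is a map $v:D\to\Gamma\cup\{\infty\}$, with $\Gamma$ an additively written totally ordered group and $\infty>\gamma$ for all $\gamma\in\Gamma$, such that $v(a)=\infty\iff a=0$, $v(ab)=v(a)+v(b)$ and $v(a+b)\ge\min\{v(a),v(b)\}$. Valuations are trivial on $\mathbb{R}$, and "residue field $\mathbb{R}$" means that the natural map from $\mathbb{R}$ to the residue division ring $\{v\ge0\}/\{v>0\}$ is an isomorphism. A valuation on an Ore domain extends uniquely to its quotient division ring and is identified with this extension. $\tilde R=\{\sum_{q\in A}a_qx^{-q}\mid a_q\in\mathbb{R},\ A\subset\mathbb{Q}\text{ well-ordered}\}$ (generalized power series), $\delta(p(x))=p'(x)$ is termwise differentiation $d/dx$, and $\tilde R[y;\delta]$ is the skew polynomial ring with $yp=py+\delta(p)$ for $p\in\tilde R$. *)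

theory Defs
  imports
    "HOL-Computational_Algebra.Polynomial"
    "HOL-Library.Extended_Nat"
    "HOL-Algebra.QuotRing"
begin

section \<open>Generalized power series\<close>

definition well_ordered :: "'a::linorder set \<Rightarrow> bool" where
  "well_ordered A \<longleftrightarrow> (\<forall>B\<subseteq>A. B \<noteq> {} \<longrightarrow> (\<exists>m\<in>B. \<forall>b\<in>B. m \<le> b))"

lemma well_orderedE:
  assumes "well_ordered A" "B \<subseteq> A" "B \<noteq> {}"
  obtains m where "m \<in> B" "\<And>b. b \<in> B \<Longrightarrow> m \<le> b"
proof -
  have "\<exists>m\<in>B. \<forall>b\<in>B. m \<le> b" using assms unfolding well_ordered_def by simp
  then show thesis using that by auto
qed

lemma well_ordered_subset: "well_ordered A \<Longrightarrow> B \<subseteq> A \<Longrightarrow> well_ordered B"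
  unfolding well_ordered_def by (meson subset_trans)

lemma well_ordered_finite:
  assumes "finite A" shows "well_ordered A"
  unfolding well_ordered_def
  by (metis Min_in Min_le assms finite_subset)

lemma well_ordered_Un:
  assumes "well_ordered A" "well_ordered B" shows "well_ordered (A \<union> B)"
  unfolding well_ordered_def
proof (intro allI impI)
  fix C assume C: "C \<subseteq> A \<union> B" "C \<noteq> {}"
  show "\<exists>m\<in>C. \<forall>b\<in>C. m \<le> b"
  proof (cases "C \<inter> A = {} \<or> C \<inter> B = {}")
    case True
    then have "C \<subseteq> A \<or> C \<subseteq> B" using C by blast
    then show ?thesis using assms C(2) unfolding well_ordered_def by blast
  next
    case False
    then obtain m where m: "m \<in> C \<inter> A" "\<And>b. b \<in> C \<inter> A \<Longrightarrow> m \<le> b"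
      by (meson assms(1) inf_le2 well_orderedE)
    from False obtain n where n: "n \<in> C \<inter> B" "\<And>b. b \<in> C \<inter> B \<Longrightarrow> n \<le> b"
      by (meson assms(2) inf_le2 well_orderedE)
    have "min m n \<in> C" using m n by (auto simp: min_def)
    moreover have "\<forall>b\<in>C. min m n \<le> b" using m(2) n(2) C(1) by (metis IntI UnE min.coboundedI1 min.coboundedI2 subsetD)
    ultimately show ?thesis by blast
  qed
qed

lemma well_ordered_fibre_finite:
  fixes A B :: "'a::linordered_ab_group_add set"
  assumes A: "well_ordered A" and B: "well_ordered B"
  shows "finite {p \<in> A. r - p \<in> B}"
proof (rule ccontr)
  define S where "S = {p \<in> A. r - p \<in> B}"
  assume "infinite {p \<in> A. r - p \<in> B}"
  then have inf: "infinite S" by (simp add: S_def)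
  have mx: "\<exists>m\<in>C. \<forall>b\<in>C. b \<le> m" if "C \<subseteq> S" "C \<noteq> {}" for C
  proof -
    have "(\<lambda>p. r - p) ` C \<subseteq> B" "(\<lambda>p. r - p) ` C \<noteq> {}" using that by (auto simp: S_def)
    then obtain m where "m \<in> (\<lambda>p. r - p) ` C" "\<And>b. b \<in> (\<lambda>p. r - p) ` C \<Longrightarrow> m \<le> b"
      using well_orderedE[OF B, of "(\<lambda>p. r - p) ` C"] by auto
    then obtain c where "c \<in> C" "\<And>b. b \<in> C \<Longrightarrow> r - c \<le> r - b" by blast
    then show ?thesis by auto
  qed
  define T where "T = {p \<in> S. infinite {q \<in> S. q \<le> p}}"
  obtain M where M: "M \<in> S" "\<forall>b\<in>S. b \<le> M" using mx[of S] inf by auto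
  then have "{q \<in> S. q \<le> M} = S" by auto
  then have "M \<in> T" using M inf by (simp add: T_def)
  moreover have "T \<subseteq> A" by (auto simp: T_def S_def)
  ultimately obtain p where p: "p \<in> T" "\<And>b. b \<in> T \<Longrightarrow> p \<le> b"
    using well_orderedE[OF A] by (metis empty_iff)
  have eq: "{q \<in> S. q \<le> p} = insert p {q \<in> S. q < p}" using p(1) by (auto simp: T_def)
  then have i: "infinite {q \<in> S. q < p}" using p(1) by (auto simp: T_def)
  then have "{q \<in> S. q < p} \<noteq> {}" by (metis finite.emptyI)
  then obtain p' where p': "p' \<in> S" "p' < p" "\<forall>b\<in>{q \<in> S. q < p}. b \<le> p'"
    using mx[of "{q \<in> S. q < p}"] by auto
  have "{q \<in> S. q < p} \<subseteq> {q \<in> S. q \<le> p'}" using p'(3) by auto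
  then have "p' \<in> T" using i p'(1) by (auto simp: T_def dest: finite_subset)
  then show False using p(2) p'(2) by force
qed

lemma well_ordered_sums:
  fixes A B :: "'a::linordered_ab_group_add set"
  assumes A: "well_ordered A" and B: "well_ordered B"
  shows "well_ordered {a + b |a b. a \<in> A \<and> b \<in> B}"
  unfolding well_ordered_def
proof (intro allI impI, rule ccontr)
  fix C assume C: "C \<subseteq> {a + b |a b. a \<in> A \<and> b \<in> B}" "C \<noteq> {}"
    and no: "\<not> (\<exists>m\<in>C. \<forall>b\<in>C. m \<le> b)"
  define good where "good a0 b0 \<longleftrightarrow> a0 \<in> A \<and> b0 \<in> B \<and> a0 + b0 \<in> C \<and>
      (\<forall>a\<in>A. \<forall>b\<in>B. a + b \<in> C \<and> a + b < a0 + b0 \<longrightarrow> a0 \<le> a)" for a0 b0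
  have ex: "\<exists>a0 b0. a0 + b0 < c \<and> good a0 b0
      \<and> (\<forall>a\<in>A. \<forall>b\<in>B. a + b \<in> C \<and> a + b < c \<longrightarrow> a0 \<le> a)" if "c \<in> C" for c
  proof -
    define X where "X = {a \<in> A. \<exists>b\<in>B. a + b \<in> C \<and> a + b < c}"
    have "\<exists>d\<in>C. d < c" using no that by (auto simp: not_le)
    then obtain d where d: "d \<in> C" "d < c" ..
    with C(1) obtain a b where "d = a + b" "a \<in> A" "b \<in> B" by auto
    then have "a \<in> X" using d by (auto simp: X_def)
    then have "X \<noteq> {}" by auto
    then obtain a0 where a0: "a0 \<in> X" "\<And>a. a \<in> X \<Longrightarrow> a0 \<le> a"
      using well_orderedE[OF A, of X] by (auto simp: X_def)
    then obtain b0 where b0: "b0 \<in> B" "a0 + b0 \<in> C" "a0 + b0 < c" by (auto simp: X_def)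
    have "\<forall>a\<in>A. \<forall>b\<in>B. a + b \<in> C \<and> a + b < c \<longrightarrow> a0 \<le> a"
      using a0(2) by (auto simp: X_def)
    moreover from this have "good a0 b0"
      using b0 a0(1) less_trans[OF _ b0(3)] unfolding good_def X_def by blast
    ultimately show ?thesis using b0 by blast
  qed
  define Y where "Y = {b0. \<exists>a0. good a0 b0}"
  obtain c where "c \<in> C" using C(2) by blast
  then have "Y \<noteq> {}" using ex[of c] by (auto simp: Y_def)
  moreover have "Y \<subseteq> B" by (auto simp: Y_def good_def)
  ultimately obtain b0 where b0: "b0 \<in> Y" "\<And>b. b \<in> Y \<Longrightarrow> b0 \<le> b"
    using well_orderedE[OF B] by metis
  then obtain a0 where g: "good a0 b0" by (auto simp: Y_def)
  obtain a1 b1 where l: "a1 + b1 < a0 + b0" and g1: "good a1 b1"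
    using ex[of "a0 + b0"] g by (auto simp: good_def)
  have "a0 \<le> a1" using g g1 l by (auto simp: good_def)
  moreover have "b0 \<le> b1" using b0(2) g1 by (auto simp: Y_def)
  ultimately show False using l by (meson add_mono not_le)
qed

text \<open>The series \<open>\<Sum>q\<in>A. a\<^sub>q x\<^sup>-\<^sup>q\<close> is represented by its coefficient function \<open>q \<mapsto> a\<^sub>q\<close>;
  the index is the negative of the exponent of \<open>x\<close>.\<close>

typedef gen_series = "{f :: rat \<Rightarrow> real. well_ordered {q. f q \<noteq> 0}}"
  morphisms gcoeff Abs_gen_series
  by (rule exI[of _ "\<lambda>_. 0"]) (simp add: well_ordered_finite)

setup_lifting type_definition_gen_series

lemma gen_series_eqI: "(\<And>q. gcoeff f q = gcoeff g q) \<Longrightarrow> f = g"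
  by (metis ext gcoeff_inject)

abbreviation gsupp :: "gen_series \<Rightarrow> rat set" where
  "gsupp f \<equiv> {q. gcoeff f q \<noteq> 0}"

lemma well_ordered_gsupp: "well_ordered (gsupp f)"
  using gcoeff[of f] by simp

instantiation gen_series :: ab_group_add
begin

lift_definition zero_gen_series :: gen_series is "\<lambda>_. 0"
  by (simp add: well_ordered_finite)

lift_definition plus_gen_series :: "gen_series \<Rightarrow> gen_series \<Rightarrow> gen_series" is "\<lambda>f g q. f q + g q"
  by (erule (1) well_ordered_subset[OF well_ordered_Un]) auto

lift_definition uminus_gen_series :: "gen_series \<Rightarrow> gen_series" is "\<lambda>f q. - f q"
  by simp

lift_definition minus_gen_series :: "gen_series \<Rightarrow> gen_series \<Rightarrow> gen_series" is "\<lambda>f g q. f q - g q"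
  by (erule (1) well_ordered_subset[OF well_ordered_Un]) auto

instance by standard (transfer; simp add: algebra_simps)+

end

lemma gcoeff_simps [simp]:
  "gcoeff 0 q = 0" "gcoeff (f + g) q = gcoeff f q + gcoeff g q"
  "gcoeff (- f) q = - gcoeff f q" "gcoeff (f - g) q = gcoeff f q - gcoeff g q"
  by (transfer; simp)+

lemma finite_gsupp_fibre: "finite {p. gcoeff f p \<noteq> 0 \<and> gcoeff g (r - p) \<noteq> 0}"
  using well_ordered_fibre_finite[OF well_ordered_gsupp[of f] well_ordered_gsupp[of g], of r]
  by simp

instantiation gen_series :: comm_ring_1
begin

lift_definition one_gen_series :: gen_series is "\<lambda>q. if q = 0 then 1 else 0"
  by (rule well_ordered_finite) simp

lift_definition times_gen_series :: "gen_series \<Rightarrow> gen_series \<Rightarrow> gen_series" is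
  "\<lambda>f g r. \<Sum>p | f p \<noteq> 0 \<and> g (r - p) \<noteq> 0. f p * g (r - p)"
proof -
  fix f g :: "rat \<Rightarrow> real"
  assume f: "well_ordered {q. f q \<noteq> 0}" and g: "well_ordered {q. g q \<noteq> 0}"
  show "well_ordered {r. (\<Sum>p | f p \<noteq> 0 \<and> g (r - p) \<noteq> 0. f p * g (r - p)) \<noteq> 0}"
  proof (rule well_ordered_subset[OF well_ordered_sums[OF f g]], safe)
    fix r assume "(\<Sum>p | f p \<noteq> 0 \<and> g (r - p) \<noteq> 0. f p * g (r - p)) \<noteq> 0"
    then have "{p. f p \<noteq> 0 \<and> g (r - p) \<noteq> 0} \<noteq> {}" by (metis sum.empty)
    then obtain p where "f p \<noteq> 0" "g (r - p) \<noteq> 0" by blast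
    then show "\<exists>a b. r = a + b \<and> a \<in> {q. f q \<noteq> 0} \<and> b \<in> {q. g q \<noteq> 0}"
      by (intro exI[of _ p] exI[of _ "r - p"]) auto
  qed
qed

lemma gcoeff_times:
  "gcoeff (f * g) r = (\<Sum>p | gcoeff f p \<noteq> 0 \<and> gcoeff g (r - p) \<noteq> 0. gcoeff f p * gcoeff g (r - p))"
  by transfer simp

lemma gcoeff_times_superset:
  assumes "finite P" "\<And>p. gcoeff f p \<noteq> 0 \<Longrightarrow> gcoeff g (r - p) \<noteq> 0 \<Longrightarrow> p \<in> P"
  shows "gcoeff (f * g) r = (\<Sum>p\<in>P. gcoeff f p * gcoeff g (r - p))"
  unfolding gcoeff_times using assms by (intro sum.mono_neutral_left) auto

lemma gcoeff_one: "gcoeff 1 q = (if q = 0 then 1 else 0)"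
  by transfer simp

instance
proof
  fix f g h :: gen_series
  show "f * g = g * f"
  proof (rule gen_series_eqI)
    fix r
    show "gcoeff (f * g) r = gcoeff (g * f) r"
      unfolding gcoeff_times
      by (rule sum.reindex_bij_witness[of _ "\<lambda>p. r - p" "\<lambda>p. r - p"]) auto
  qed
  show "1 * f = f"
  proof (rule gen_series_eqI)
    fix r
    show "gcoeff (1 * f) r = gcoeff f r"
      by (subst gcoeff_times_superset[of "{0}"]) (auto simp: gcoeff_one split: if_splits)
  qed
  show "(f + g) * h = f * h + g * h"
  proof (rule gen_series_eqI)
    fix r
    let ?P = "{p. gcoeff f p \<noteq> 0 \<and> gcoeff h (r - p) \<noteq> 0} \<union> {p. gcoeff g p \<noteq> 0 \<and> gcoeff h (r - p) \<noteq> 0}"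
    have fin: "finite ?P" using finite_gsupp_fibre by blast
    show "gcoeff ((f + g) * h) r = gcoeff (f * h + g * h) r"
      unfolding gcoeff_simps(2)[of "f * h"]
      using gcoeff_times_superset[OF fin, of "f + g" h r] gcoeff_times_superset[OF fin, of f h r]
        gcoeff_times_superset[OF fin, of g h r]
      by (auto simp: distrib_right sum.distrib)
  qed
  have "gcoeff (0::gen_series) 0 \<noteq> gcoeff 1 0" by (simp add: gcoeff_one)
  then show "(0::gen_series) \<noteq> 1" by metis
  show "f * g * h = f * (g * h)"
  proof (rule gen_series_eqI)
    fix r
    let ?A = "gsupp f" and ?B = "gsupp g" and ?C = "gsupp h"
    let ?AB = "{a + b |a b. a \<in> ?A \<and> b \<in> ?B}" and ?BC = "{a + b |a b. a \<in> ?B \<and> b \<in> ?C}"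
    define S where "S = {s \<in> ?AB. r - s \<in> ?C}"
    define U where "U = {p \<in> ?A. r - p \<in> ?BC}"
    have wo: "well_ordered ?AB" "well_ordered ?BC"
      using well_ordered_sums[OF well_ordered_gsupp well_ordered_gsupp] by auto
    have fS: "finite S" unfolding S_def by (rule well_ordered_fibre_finite[OF wo(1) well_ordered_gsupp])
    have fU: "finite U" unfolding U_def by (rule well_ordered_fibre_finite[OF well_ordered_gsupp wo(2)])
    have nzAB: "s \<in> ?AB" if "gcoeff (f * g) s \<noteq> 0" for s
    proof -
      have "{p. gcoeff f p \<noteq> 0 \<and> gcoeff g (s - p) \<noteq> 0} \<noteq> {}"
        using that unfolding gcoeff_times by (metis sum.empty)
      then obtain p where "gcoeff f p \<noteq> 0" "gcoeff g (s - p) \<noteq> 0" by blast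
      then show ?thesis by (intro CollectI exI[of _ p] exI[of _ "s - p"]) auto
    qed
    have nzBC: "s \<in> ?BC" if "gcoeff (g * h) s \<noteq> 0" for s
    proof -
      have "{p. gcoeff g p \<noteq> 0 \<and> gcoeff h (s - p) \<noteq> 0} \<noteq> {}"
        using that unfolding gcoeff_times by (metis sum.empty)
      then obtain p where "gcoeff g p \<noteq> 0" "gcoeff h (s - p) \<noteq> 0" by blast
      then show ?thesis by (intro CollectI exI[of _ p] exI[of _ "s - p"]) auto
    qed
    let ?P = "\<lambda>s. {p. gcoeff f p \<noteq> 0 \<and> gcoeff g (s - p) \<noteq> 0}"
    let ?Q = "\<lambda>p. {q. gcoeff g q \<noteq> 0 \<and> gcoeff h (r - p - q) \<noteq> 0}"
    have "gcoeff (f * g * h) r = (\<Sum>s\<in>S. gcoeff (f * g) s * gcoeff h (r - s))"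
      using nzAB by (intro gcoeff_times_superset fS) (auto simp: S_def)
    also have "\<dots> = (\<Sum>s\<in>S. \<Sum>p\<in>?P s. gcoeff f p * gcoeff g (s - p) * gcoeff h (r - s))"
      by (simp add: gcoeff_times sum_distrib_right)
    also have "\<dots> = (\<Sum>(s,p)\<in>Sigma S ?P. gcoeff f p * gcoeff g (s - p) * gcoeff h (r - s))"
      using fS finite_gsupp_fibre by (intro sum.Sigma) auto
    also have "\<dots> = (\<Sum>(p,q)\<in>Sigma U ?Q. gcoeff f p * (gcoeff g q * gcoeff h (r - p - q)))"
    proof (rule sum.reindex_bij_witness[of _ "\<lambda>(p,q). (p + q, p)" "\<lambda>(s,p). (p, s - p)"])
      fix a assume "a \<in> Sigma S ?P"
      then obtain s p where a: "a = (s, p)" "s \<in> S" "gcoeff f p \<noteq> 0" "gcoeff g (s - p) \<noteq> 0" by auto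
      have "r - p = (s - p) + (r - s)" by simp
      then have "r - p \<in> ?BC" using a(2,4) unfolding S_def
        by (intro CollectI exI[of _ "s - p"] exI[of _ "r - s"]) auto
      then show "(case a of (s, p) \<Rightarrow> (p, s - p)) \<in> Sigma U ?Q" using a by (auto simp: U_def S_def)
    next
      fix b assume "b \<in> Sigma U ?Q"
      then obtain p q where b: "b = (p, q)" "p \<in> U" "gcoeff g q \<noteq> 0" "gcoeff h (r - p - q) \<noteq> 0" by auto
      then show "(case b of (p, q) \<Rightarrow> (p + q, p)) \<in> Sigma S ?P"
        by (auto simp: U_def S_def diff_diff_eq)
    qed (auto simp: mult.assoc)
    also have "\<dots> = (\<Sum>p\<in>U. \<Sum>q\<in>?Q p. gcoeff f p * (gcoeff g q * gcoeff h (r - p - q)))"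
      using fU finite_gsupp_fibre by (intro sum.Sigma[symmetric]) auto
    also have "\<dots> = (\<Sum>p\<in>U. gcoeff f p * gcoeff (g * h) (r - p))"
      by (simp add: gcoeff_times sum_distrib_left)
    also have "\<dots> = gcoeff (f * (g * h)) r"
      using nzBC by (intro gcoeff_times_superset[symmetric] fU) (auto simp: U_def)
    finally show "gcoeff (f * g * h) r = gcoeff (f * (g * h)) r" .
  qed
qed

end

instantiation gen_series :: real_algebra_1
begin

lift_definition scaleR_gen_series :: "real \<Rightarrow> gen_series \<Rightarrow> gen_series" is "\<lambda>c f q. c * f q"
  by (erule well_ordered_subset) auto

lemma gcoeff_scaleR [simp]: "gcoeff (c *\<^sub>R f) q = c * gcoeff f q"
  by transfer simp

instance
proof
  fix a b :: real and f g :: gen_series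
  show "a *\<^sub>R (f + g) = a *\<^sub>R f + a *\<^sub>R g" "(a + b) *\<^sub>R f = a *\<^sub>R f + b *\<^sub>R f"
    "a *\<^sub>R b *\<^sub>R f = (a * b) *\<^sub>R f" "1 *\<^sub>R f = f"
    by (rule gen_series_eqI; simp add: algebra_simps)+
  show *: "a *\<^sub>R f * g = a *\<^sub>R (f * g)" for f g :: gen_series
  proof (rule gen_series_eqI)
    fix r
    show "gcoeff (a *\<^sub>R f * g) r = gcoeff (a *\<^sub>R (f * g)) r"
      by (subst gcoeff_times_superset[OF finite_gsupp_fibre[of f g r]])
        (auto simp: gcoeff_times sum_distrib_left mult.assoc)
  qed
  show "f * a *\<^sub>R g = a *\<^sub>R (f * g)" using *[of g f] by (simp add: mult.commute)
qed

end

section \<open>Skew polynomial rings of derivation type\<close>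

class real_differential_algebra = real_algebra_1 + comm_ring_1 +
  fixes derivation :: "'a \<Rightarrow> 'a" (\<open>\<delta>\<close>)
  assumes derivation_add: "\<delta> (a + b) = \<delta> a + \<delta> b"
    and derivation_mult: "\<delta> (a * b) = \<delta> a * b + a * \<delta> b"
    and derivation_scaleR: "\<delta> (c *\<^sub>R a) = c *\<^sub>R \<delta> a"

lemma derivation_0 [simp]: "\<delta> (0::'a::real_differential_algebra) = 0"
  using derivation_add[of "0::'a" 0] by simp

lemma derivation_of_real [simp]: "\<delta> (of_real c :: 'a::real_differential_algebra) = 0"
  using derivation_mult[of "1::'a" 1] derivation_scaleR[of c "1::'a"] by (simp add: of_real_def)

text \<open>Since \<open>d/dx x\<^sup>-\<^sup>q = -q x\<^sup>-\<^sup>(\<^sup>q\<^sup>+\<^sup>1\<^sup>)\<close>, the coefficient of \<open>x\<^sup>-\<^sup>r\<close> in \<open>\<delta> f\<close> is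
  \<open>-(r - 1)\<close> times the coefficient of \<open>x\<^sup>-\<^sup>(\<^sup>r\<^sup>-\<^sup>1\<^sup>)\<close> in \<open>f\<close>.\<close>

instantiation gen_series :: real_differential_algebra
begin

lift_definition derivation_gen_series :: "gen_series \<Rightarrow> gen_series" is
  "\<lambda>f r. - of_rat (r - 1) * f (r - 1)"
proof -
  fix f :: "rat \<Rightarrow> real" assume f: "well_ordered {q. f q \<noteq> 0}"
  show "well_ordered {r. - of_rat (r - 1) * f (r - 1) \<noteq> 0}"
    by (rule well_ordered_subset[OF well_ordered_sums[OF f well_ordered_finite[of "{1}"]]])
      (auto intro: exI[of _ "_ - 1"])
qed

lemma gcoeff_derivation: "gcoeff (\<delta> f) r = - of_rat (r - 1) * gcoeff f (r - 1)"
  by transfer simp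

instance
proof
  fix f g :: gen_series and c :: real
  show "\<delta> (f + g) = \<delta> f + \<delta> g" "\<delta> (c *\<^sub>R f) = c *\<^sub>R \<delta> f"
    by (rule gen_series_eqI; simp add: gcoeff_derivation algebra_simps)+
  show "\<delta> (f * g) = \<delta> f * g + f * \<delta> g"
  proof (rule gen_series_eqI)
    fix r
    define P where "P = {p. gcoeff f p \<noteq> 0 \<and> gcoeff g (r - 1 - p) \<noteq> 0}"
    have fin: "finite P" unfolding P_def by (rule finite_gsupp_fibre)
    have "gcoeff (\<delta> f * g) r = (\<Sum>p\<in>(\<lambda>p. p + 1) ` P. gcoeff (\<delta> f) p * gcoeff g (r - p))"
    proof (rule gcoeff_times_superset)
      fix p assume "gcoeff (\<delta> f) p \<noteq> 0" "gcoeff g (r - p) \<noteq> 0"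
      then have "p - 1 \<in> P" by (auto simp: P_def gcoeff_derivation)
      then show "p \<in> (\<lambda>p. p + 1) ` P" by (rule rev_image_eqI) simp
    qed (simp add: fin)
    also have "\<dots> = (\<Sum>p\<in>P. - of_rat p * gcoeff f p * gcoeff g (r - 1 - p))"
      by (subst sum.reindex) (auto simp: gcoeff_derivation inj_on_def algebra_simps)
    finally have 1: "gcoeff (\<delta> f * g) r = \<dots>" .
    have 2: "gcoeff (f * \<delta> g) r = (\<Sum>p\<in>P. gcoeff f p * gcoeff (\<delta> g) (r - p))"
      by (rule gcoeff_times_superset[OF fin])
        (auto simp: P_def gcoeff_derivation algebra_simps)
    have "gcoeff (\<delta> (f * g)) r = (\<Sum>p\<in>P. - of_rat (r - 1) * gcoeff f p * gcoeff g (r - 1 - p))"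
      unfolding gcoeff_derivation by (simp add: gcoeff_times P_def sum_distrib_left mult.assoc)
    also have "\<dots> = (\<Sum>p\<in>P. - of_rat p * gcoeff f p * gcoeff g (r - 1 - p)
        + gcoeff f p * gcoeff (\<delta> g) (r - p))"
    proof (rule sum.cong)
      fix p
      have "r - p - 1 = r - 1 - p" by simp
      moreover have "(of_rat (r - 1) :: real) = of_rat p + of_rat (r - p - 1)"
        by (simp flip: of_rat_add)
      ultimately show "- of_rat (r - 1) * gcoeff f p * gcoeff g (r - 1 - p) =
        - of_rat p * gcoeff f p * gcoeff g (r - 1 - p) + gcoeff f p * gcoeff (\<delta> g) (r - p)"
        unfolding gcoeff_derivation by (simp add: algebra_simps)
    qed simp
    also have "\<dots> = gcoeff (\<delta> f * g + f * \<delta> g) r"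
      unfolding sum.distrib gcoeff_simps 1 2 ..
    finally show "gcoeff (\<delta> (f * g)) r = gcoeff (\<delta> f * g + f * \<delta> g) r" .
  qed
qed

end

text \<open>An element of \<open>R[y;\<delta>]\<close> is written \<open>\<Sum>n. p\<^sub>n y\<^sup>n\<close>, with coefficients on the left,
  and represented by the polynomial with coefficients \<open>p\<^sub>n\<close>; only the multiplication differs
  from that of ordinary polynomials.\<close>

typedef (overloaded) 'a skew_poly = "UNIV :: 'a::real_differential_algebra poly set"
  morphisms poly_of_skew skew_of_poly by simp

setup_lifting type_definition_skew_poly

text \<open>Left multiplication by \<open>y\<close>: \<open>y (\<Sum>n. p\<^sub>n y\<^sup>n) = \<Sum>n. p\<^sub>n y\<^sup>n\<^sup>+\<^sup>1 + \<Sum>n. \<delta>(p\<^sub>n) y\<^sup>n\<close>.\<close>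

definition left_y :: "'a::real_differential_algebra poly \<Rightarrow> 'a poly" where
  "left_y p = pCons 0 p + map_poly \<delta> p"

definition skew_times :: "'a::real_differential_algebra poly \<Rightarrow> 'a poly \<Rightarrow> 'a poly" where
  "skew_times f g = (\<Sum>i\<le>degree f. smult (coeff f i) ((left_y ^^ i) g))"

lemma coeff_left_y:
  "coeff (left_y p) n = (case n of 0 \<Rightarrow> 0 | Suc m \<Rightarrow> coeff p m) + \<delta> (coeff p n)"
  by (simp add: left_y_def coeff_pCons coeff_map_poly)

lemma left_y_add: "left_y (p + q) = left_y p + left_y q"
  by (rule poly_eqI) (simp add: coeff_left_y derivation_add split: nat.split)

lemma left_y_0 [simp]: "left_y 0 = 0"
  by (rule poly_eqI) (simp add: coeff_left_y split: nat.split)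

lemma left_y_smult: "left_y (smult a p) = smult a (left_y p) + smult (\<delta> a) p"
  by (rule poly_eqI) (simp add: coeff_left_y derivation_mult algebra_simps split: nat.split)

lemma left_y_sum: "left_y (\<Sum>i\<in>A. f i) = (\<Sum>i\<in>A. left_y (f i))"
  by (induction A rule: infinite_finite_induct) (auto simp: left_y_add)

lemma left_y_pow_add: "(left_y ^^ n) (p + q) = (left_y ^^ n) p + (left_y ^^ n) q"
  by (induction n) (auto simp: left_y_add)

lemma left_y_pow_0: "(left_y ^^ n) 0 = 0"
  by (induction n) auto

lemma left_y_pow_of_real: "(left_y ^^ n) (smult (of_real c) p) = smult (of_real c) ((left_y ^^ n) p)"
  by (induction n) (auto simp: left_y_smult)

lemma skew_times_bound:
  assumes "degree f \<le> n"
  shows "skew_times f g = (\<Sum>i\<le>n. smult (coeff f i) ((left_y ^^ i) g))"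
  unfolding skew_times_def using assms
  by (intro sum.mono_neutral_left) (auto simp: coeff_eq_0)

lemma smult_sum_right: "smult a (\<Sum>i\<in>A. f i) = (\<Sum>i\<in>A. smult a (f i))"
  by (induction A rule: infinite_finite_induct) (auto simp: smult_add_right)

lemma skew_times_add_left: "skew_times (f + g) h = skew_times f h + skew_times g h"
proof -
  let ?n = "max (degree f) (degree g)"
  show ?thesis
    using skew_times_bound[of "f + g" ?n h] skew_times_bound[of f ?n h] skew_times_bound[of g ?n h]
    by (simp add: degree_add_le_max smult_add_left sum.distrib)
qed

lemma skew_times_add_right: "skew_times f (g + h) = skew_times f g + skew_times f h"
  by (simp add: skew_times_def left_y_pow_add smult_add_right sum.distrib)

lemma skew_times_smult_left: "skew_times (smult a f) g = smult a (skew_times f g)"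
  by (subst skew_times_bound[OF degree_smult_le])
    (simp add: skew_times_def smult_sum_right)

lemma skew_times_0_left: "skew_times 0 g = 0"
  by (simp add: skew_times_def)

lemma skew_times_sum_left: "skew_times (\<Sum>i\<in>A. f i) g = (\<Sum>i\<in>A. skew_times (f i) g)"
  by (induction A rule: infinite_finite_induct) (auto simp: skew_times_add_left skew_times_0_left)

lemma skew_times_of_real_right:
  "skew_times f (smult (of_real c) g) = smult (of_real c) (skew_times f g)"
  by (simp add: skew_times_def left_y_pow_of_real smult_sum_right mult.commute)

lemma skew_times_left_y: "skew_times (left_y f) g = left_y (skew_times f g)"
proof -
  have d: "degree (map_poly \<delta> f) \<le> degree f" by (rule degree_le) (simp add: coeff_map_poly coeff_eq_0)
  have "skew_times (pCons 0 f) g = (\<Sum>i\<le>Suc (degree f). smult (coeff (pCons 0 f) i) ((left_y ^^ i) g))"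
    by (rule skew_times_bound) (simp add: degree_pCons_le)
  also have "\<dots> = (\<Sum>i\<le>degree f. smult (coeff f i) (left_y ((left_y ^^ i) g)))"
    by (simp only: sum.atMost_Suc_shift) simp
  finally have 1: "skew_times (pCons 0 f) g = \<dots>" .
  show ?thesis
    unfolding left_y_def[of f] skew_times_add_left 1 skew_times_bound[OF d]
    by (simp add: skew_times_def left_y_sum left_y_smult sum.distrib coeff_map_poly)
qed

lemma skew_times_left_y_pow: "skew_times ((left_y ^^ n) f) g = (left_y ^^ n) (skew_times f g)"
  by (induction n) (auto simp: skew_times_left_y)

lemma skew_times_assoc: "skew_times (skew_times f g) h = skew_times f (skew_times g h)"
  by (simp add: skew_times_def[of f] skew_times_sum_left skew_times_smult_left skew_times_left_y_pow)

lemma skew_times_1_left: "skew_times 1 g = g"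
  by (simp add: skew_times_def)

lemma skew_times_1_right: "skew_times f 1 = f"
proof -
  have "(left_y ^^ i) 1 = monom (1::'a) i" for i
  proof (induction i)
    case (Suc i)
    have "\<delta> (1::'a) = 0" using derivation_of_real[of 1] by simp
    then have "map_poly \<delta> (monom (1::'a) i) = 0"
      by (intro poly_eqI) (auto simp: coeff_map_poly)
    then show ?case using Suc by (simp add: left_y_def monom_Suc)
  qed simp
  then show ?thesis
    by (simp add: skew_times_def smult_monom poly_as_sum_of_monoms)
qed

instantiation skew_poly :: (real_differential_algebra) real_algebra_1
begin

lift_definition zero_skew_poly :: "'a skew_poly" is 0 .
lift_definition one_skew_poly :: "'a skew_poly" is 1 .
lift_definition plus_skew_poly :: "'a skew_poly \<Rightarrow> 'a skew_poly \<Rightarrow> 'a skew_poly" is "(+)" .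
lift_definition minus_skew_poly :: "'a skew_poly \<Rightarrow> 'a skew_poly \<Rightarrow> 'a skew_poly" is "(-)" .
lift_definition uminus_skew_poly :: "'a skew_poly \<Rightarrow> 'a skew_poly" is uminus .
lift_definition times_skew_poly :: "'a skew_poly \<Rightarrow> 'a skew_poly \<Rightarrow> 'a skew_poly" is skew_times .
lift_definition scaleR_skew_poly :: "real \<Rightarrow> 'a skew_poly \<Rightarrow> 'a skew_poly" is
  "\<lambda>c. smult (of_real c)" .

instance
proof
  fix a b c :: "'a skew_poly" and r s :: real
  show "a + b + c = a + (b + c)" "a + b = b + a" "0 + a = a" "- a + a = 0" "a - b = a + - b"
    by (transfer; simp)+
  show "r *\<^sub>R (a + b) = r *\<^sub>R a + r *\<^sub>R b" "(r + s) *\<^sub>R a = r *\<^sub>R a + s *\<^sub>R a"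
    "r *\<^sub>R s *\<^sub>R a = (r * s) *\<^sub>R a" "1 *\<^sub>R a = a"
    by (transfer; simp add: smult_add_right smult_add_left)+
  show "a * b * c = a * (b * c)" by transfer (rule skew_times_assoc)
  show "(a + b) * c = a * c + b * c" by transfer (rule skew_times_add_left)
  show "a * (b + c) = a * b + a * c" by transfer (rule skew_times_add_right)
  show "1 * a = a" by transfer (rule skew_times_1_left)
  show "a * 1 = a" by transfer (rule skew_times_1_right)
  show "(0::'a skew_poly) \<noteq> 1" by transfer simp
  show "r *\<^sub>R a * b = r *\<^sub>R (a * b)" by transfer (rule skew_times_smult_left)
  show "a * r *\<^sub>R b = r *\<^sub>R (a * b)" by transfer (rule skew_times_of_real_right)
qed

end

lift_definition skew_const :: "'a::real_differential_algebra \<Rightarrow> 'a skew_poly" is "\<lambda>p. [:p:]" .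

lift_definition skew_y :: "'a::real_differential_algebra skew_poly" is "[:0, 1:]" .

lemma skew_const_add: "skew_const (p + q) = skew_const p + skew_const q"
  by transfer simp

lemma skew_const_mult: "skew_const (p * q) = skew_const p * skew_const q"
  by transfer (simp add: skew_times_def)

lemma skew_const_of_real: "skew_const (of_real r) = of_real r"
proof -
  have "skew_const (of_real r) = r *\<^sub>R (1 :: 'a skew_poly)"
    by transfer (simp add: one_pCons)
  then show ?thesis by (simp add: of_real_def)
qed

lemma skew_y_commutation: "skew_y * skew_const p = skew_const p * skew_y + skew_const (\<delta> p)"
  by transfer (simp add: skew_times_def left_y_def map_poly_pCons)

section \<open>Valuations\<close>

text \<open>Totally ordered groups, written additively but not assumed to be abelian.\<close>

class linordered_group_add = group_add + linorder +
  assumes group_add_left_mono: "a \<le> b \<Longrightarrow> c + a \<le> c + b"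
    and group_add_right_mono: "a \<le> b \<Longrightarrow> a + c \<le> b + c"

datatype 'g with_infinity = Val 'g | Infty

instantiation with_infinity :: (linorder) linorder
begin

fun less_eq_with_infinity :: "'a with_infinity \<Rightarrow> 'a with_infinity \<Rightarrow> bool" where
  "Val a \<le> Val b \<longleftrightarrow> a \<le> b"
| "_ \<le> Infty \<longleftrightarrow> True"
| "Infty \<le> Val _ \<longleftrightarrow> False"

definition less_with_infinity :: "'a with_infinity \<Rightarrow> 'a with_infinity \<Rightarrow> bool" where
  "a < b \<longleftrightarrow> a \<le> b \<and> \<not> b \<le> (a :: 'a with_infinity)"

instance
proof
  fix x y z :: "'a with_infinity"
  show "x < y \<longleftrightarrow> x \<le> y \<and> \<not> y \<le> x" by (rule less_with_infinity_def)
  show "x \<le> x" by (cases x) auto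
  show "x \<le> y \<or> y \<le> x" by (cases x; cases y) auto
  show "x = y" if "x \<le> y" "y \<le> x" using that by (cases x; cases y) auto
  show "x \<le> z" if "x \<le> y" "y \<le> z" using that by (cases x; cases y; cases z) auto
qed

end

instantiation with_infinity :: (monoid_add) monoid_add
begin

fun plus_with_infinity :: "'a with_infinity \<Rightarrow> 'a with_infinity \<Rightarrow> 'a with_infinity" where
  "Val a + Val b = Val (a + b)"
| "_ + Infty = Infty"
| "Infty + Val _ = Infty"

definition zero_with_infinity :: "'a with_infinity" where
  "0 = Val 0"

instance
proof
  fix a b c :: "'a with_infinity"
  show "a + b + c = a + (b + c)" by (cases a; cases b; cases c) (auto simp: add.assoc)
  show "0 + a = a" "a + 0 = a" by (cases a; simp add: zero_with_infinity_def)+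
qed

end

definition is_valuation ::
    "('a::real_algebra_1 \<Rightarrow> 'g::linordered_group_add with_infinity) \<Rightarrow> bool" where
  "is_valuation v \<longleftrightarrow>
     (\<forall>a. v a = Infty \<longleftrightarrow> a = 0) \<and>
     (\<forall>a b. v (a * b) = v a + v b) \<and>
     (\<forall>a b. min (v a) (v b) \<le> v (a + b)) \<and>
     (\<forall>r::real. r \<noteq> 0 \<longrightarrow> v (of_real r) = 0)"

definition value_group :: "('a::zero \<Rightarrow> 'g with_infinity) \<Rightarrow> 'g set" where
  "value_group v = {g. \<exists>a. a \<noteq> 0 \<and> v a = Val g}"

definition valuation_ring :: "('d::division_ring \<Rightarrow> 'g::linordered_group_add with_infinity) \<Rightarrow> 'd ring" where
  "valuation_ring v = \<lparr>carrier = {a. 0 \<le> v a}, mult = (*), one = 1, zero = 0, add = (+)\<rparr>"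

definition valuation_ideal :: "('d::division_ring \<Rightarrow> 'g::linordered_group_add with_infinity) \<Rightarrow> 'd set" where
  "valuation_ideal v = {a. 0 < v a}"

definition residue_ring :: "('d::division_ring \<Rightarrow> 'g::linordered_group_add with_infinity) \<Rightarrow> 'd set ring" where
  "residue_ring v = valuation_ring v Quot valuation_ideal v"

definition real_ring :: "real ring" where
  "real_ring = \<lparr>carrier = UNIV, mult = (*), one = 1, zero = 0, add = (+)\<rparr>"

definition residue_field_is_real ::
    "('d::real_div_algebra \<Rightarrow> 'g::linordered_group_add with_infinity) \<Rightarrow> bool" where
  "residue_field_is_real v \<longleftrightarrow>
     (\<lambda>r. valuation_ideal v +>\<^bsub>valuation_ring v\<^esub> of_real r) \<in> ring_iso real_ring (residue_ring v)"

text \<open>\<open>\<iota>\<close> exhibits \<open>'d\<close> as the quotient division ring of its domain (which, when that domain is a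
  two-sided Ore domain, is determined up to unique isomorphism and consists equally of right and
  of left fractions).\<close>

definition is_quotient_division_ring :: "('a::real_algebra_1 \<Rightarrow> 'd::real_div_algebra) \<Rightarrow> bool" where
  "is_quotient_division_ring \<iota> \<longleftrightarrow>
     inj \<iota> \<and>
     (\<forall>a b. \<iota> (a + b) = \<iota> a + \<iota> b) \<and>
     (\<forall>a b. \<iota> (a * b) = \<iota> a * \<iota> b) \<and>
     (\<forall>r. \<iota> (of_real r) = of_real r) \<and>
     (\<forall>d. \<exists>a b. b \<noteq> 0 \<and> d = \<iota> a * inverse (\<iota> b))"

section \<open>Rational rank\<close>

definition int_multiple :: "int \<Rightarrow> 'g::group_add \<Rightarrow> 'g" where
  "int_multiple n g = (if 0 \<le> n then ((+) g ^^ nat n) 0 else - (((+) g ^^ nat (- n)) 0))"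

definition int_independent :: "'g::group_add list \<Rightarrow> bool" where
  "int_independent gs \<longleftrightarrow>
     (\<forall>ns. length ns = length gs \<and> sum_list (map2 int_multiple ns gs) = 0 \<longrightarrow> (\<forall>n\<in>set ns. n = 0))"

text \<open>The maximal number of \<open>\<int>\<close>-linearly independent elements, which for an abelian group \<open>G\<close> is
  the dimension of \<open>\<rat> \<otimes> G\<close>. For totally ordered groups the value \<open>1\<close> forces commutativity, because
  two elements with a common nonzero multiple commute; hence ``rank one'' has its usual
  meaning even when the ambient group is not assumed to be abelian.\<close>

definition rational_rank :: "'g::group_add set \<Rightarrow> enat" where
  "rational_rank G = (SUP gs \<in> {gs. set gs \<subseteq> G \<and> int_independent gs}. enat (length gs))"

end

(* The derivation plays no role. Because squares are plentiful among the generalized power series and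
   the residue field is formally real, a valuation with residue field R must restrict to the usual
   order valuation on them, up to an embedding of Q into the value group. If the rational rank is
   one, the value group is that copy of Q, so the quotient division ring is an immediate extension
   of the generalized power series. These are maximally complete, so the extension is trivial,
   although y does not lie in the image of the constants. *)
theory Submission
  imports Defs
begin

section \<open>Generalized power series\<close>

lift_definition gmonom :: "rat \<Rightarrow> gen_series" is "\<lambda>p q. if q = p then 1 else 0"
  by (rule well_ordered_finite) simp

lemma gcoeff_gmonom: "gcoeff (gmonom p) q = (if q = p then 1 else 0)"
  by transfer simp

lemma gcoeff_gmonom_times: "gcoeff (gmonom p * f) r = gcoeff f (r - p)"
  by (subst gcoeff_times_superset[of "{p}"]) (auto simp: gcoeff_gmonom split: if_splits)

lemma gmonom_add: "gmonom (p + q) = gmonom p * gmonom q"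
  by (rule gen_series_eqI) (auto simp: gcoeff_gmonom_times gcoeff_gmonom)

lemma gmonom_0: "gmonom 0 = 1"
  by (rule gen_series_eqI) (simp add: gcoeff_gmonom gcoeff_one)

lemma gmonom_inverse: "gmonom p * gmonom (- p) = 1"
  by (simp add: gmonom_0 flip: gmonom_add)

text \<open>A nonempty subset \<open>B\<close> of the support has a minimum as soon as its part
  below one of its elements \<open>q\<close> has one, and that part lies in the support of a genuine
  series.\<close>

lemma gen_series_glue:
  assumes "\<And>q. c q \<noteq> 0 \<Longrightarrow> \<exists>f. \<forall>p\<le>q. gcoeff f p = c p"
  shows "\<exists>f. \<forall>q. gcoeff f q = c q"
proof -
  have "well_ordered {q. c q \<noteq> 0}"
    unfolding well_ordered_def
  proof (intro allI impI)
    fix B assume B: "B \<subseteq> {q. c q \<noteq> 0}" "B \<noteq> {}"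
    then obtain q where q: "q \<in> B" by blast
    with B obtain f where f: "\<forall>p\<le>q. gcoeff f p = c p" using assms by blast
    have "{p \<in> B. p \<le> q} \<subseteq> gsupp f" "{p \<in> B. p \<le> q} \<noteq> {}" using B f q by auto
    then obtain m where m: "m \<in> {p \<in> B. p \<le> q}" "\<And>b. b \<in> {p \<in> B. p \<le> q} \<Longrightarrow> m \<le> b"
      by (rule well_orderedE[OF well_ordered_gsupp[of f]]) blast
    have "m \<le> b" if "b \<in> B" for b
      using m that by (cases "b \<le> q") auto
    then show "\<exists>m\<in>B. \<forall>b\<in>B. m \<le> b" using m(1) by blast
  qed
  then have "gcoeff (Abs_gen_series c) q = c q" for q
    by (simp add: Abs_gen_series_inverse)
  then show ?thesis by blast
qed

section \<open>Order of vanishing and contractions\<close>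

definition vanishes_below :: "rat \<Rightarrow> gen_series \<Rightarrow> bool" where
  "vanishes_below t f \<longleftrightarrow> (\<forall>q<t. gcoeff f q = 0)"

lemma vanishes_below_0 [simp]: "vanishes_below t 0"
  by (simp add: vanishes_below_def)

lemma vanishes_below_add: "vanishes_below t f \<Longrightarrow> vanishes_below t g \<Longrightarrow> vanishes_below t (f + g)"
  by (simp add: vanishes_below_def)

lemma vanishes_below_diff: "vanishes_below t f \<Longrightarrow> vanishes_below t g \<Longrightarrow> vanishes_below t (f - g)"
  by (simp add: vanishes_below_def)

lemma vanishes_below_scaleR: "vanishes_below t f \<Longrightarrow> vanishes_below t (c *\<^sub>R f)"
  by (simp add: vanishes_below_def)

lemma vanishes_below_mono: "vanishes_below t f \<Longrightarrow> s \<le> t \<Longrightarrow> vanishes_below s f"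
  by (simp add: vanishes_below_def)

lemma vanishes_below_times:
  assumes "vanishes_below s f" "vanishes_below t g" shows "vanishes_below (s + t) (f * g)"
  unfolding vanishes_below_def
proof (intro allI impI)
  fix r assume r: "r < s + t"
  have "p \<in> {}" if "gcoeff f p \<noteq> 0" "gcoeff g (r - p) \<noteq> 0" for p
  proof -
    have "s \<le> p" "t \<le> r - p" using assms that unfolding vanishes_below_def by (meson not_le)+
    then show ?thesis using r by linarith
  qed
  then show "gcoeff (f * g) r = 0" by (subst gcoeff_times_superset[of "{}"]) auto
qed

text \<open>Since \<open>\<rat>\<close> is archimedean, Banach iteration stabilizes in each coefficient after finitely many
  steps.\<close>

lemma gen_series_fixpoint:
  assumes e: "0 < e"
    and inv: "\<And>f. vanishes_below e f \<Longrightarrow> vanishes_below e (F f)"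
    and contr: "\<And>f g t. vanishes_below e f \<Longrightarrow> vanishes_below e g \<Longrightarrow> vanishes_below t (f - g) \<Longrightarrow>
      vanishes_below (t + e) (F f - F g)"
  obtains f where "vanishes_below e f" "F f = f"
proof -
  define a where "a n = (F ^^ n) 0" for n
  have a_Suc: "a (Suc n) = F (a n)" for n by (simp add: a_def)
  have a_e: "vanishes_below e (a n)" for n
    by (induction n) (auto simp: a_def inv)
  have step: "vanishes_below (of_nat (Suc n) * e) (a (Suc n) - a n)" for n
  proof (induction n)
    case 0
    then show ?case using a_e[of 1] by (simp add: a_def)
  next
    case (Suc n)
    then have "vanishes_below (of_nat (Suc n) * e + e) (F (a (Suc n)) - F (a n))"
      by (rule contr[OF a_e a_e])
    then show ?case by (simp add: a_Suc algebra_simps)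
  qed
  have cauchy: "vanishes_below (of_nat (Suc n) * e) (a m - a n)" if "n \<le> m" for m n
    using that
  proof (induction m rule: dec_induct)
    case (step m)
    have "of_nat (Suc n) * e \<le> of_nat (Suc m) * e" using e step(1) by simp
    then have "vanishes_below (of_nat (Suc n) * e) (a (Suc m) - a m)"
      using \<open>\<And>n. vanishes_below (of_nat (Suc n) * e) (a (Suc n) - a n)\<close> vanishes_below_mono by blast
    from vanishes_below_add[OF this step.IH] show ?case by simp
  qed simp
  have eq: "gcoeff (a m) q = gcoeff (a n) q" if "q < of_nat m * e" "q < of_nat n * e" for m n q
    using that
  proof (induction m n rule: linorder_wlog)
    case (le m n)
    have "of_nat m * e \<le> of_nat (Suc m) * e" using e by simp
    then have "q < of_nat (Suc m) * e" using le(2) by (rule less_le_trans[rotated])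
    then show ?case using cauchy[OF le(1)] by (simp add: vanishes_below_def)
  qed simp
  \<comment> \<open>By \<open>eq\<close>, the iterates \<open>a n\<close> with
    \<open>q < of_nat n * e\<close> share their coefficient at \<open>q\<close>; \<open>N q\<close>
    is one such index.\<close>
  define N where "N q = (SOME n. q < of_nat n * e)" for q
  have N: "q < of_nat (N q) * e" for q
    unfolding N_def using ex_less_of_nat_mult[OF e] by (rule someI_ex)
  \<comment> \<open>The witness is \<open>a (N q)\<close>, which is already stable at every
    \<open>p \<le> q\<close>.\<close>
  have "\<exists>f. \<forall>p\<le>q. gcoeff f p = gcoeff (a (N p)) p" for q
    using eq[OF le_less_trans[OF _ N] N] by blast
  from gen_series_glue[of "\<lambda>q. gcoeff (a (N q)) q", OF this]
  obtain f where f: "\<And>q. gcoeff f q = gcoeff (a (N q)) q" by blast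
  have f_a: "vanishes_below (of_nat n * e) (f - a n)" for n
    using eq[OF N] unfolding vanishes_below_def gcoeff_simps f by (metis diff_self)
  have f_e: "vanishes_below e f"
    using vanishes_below_add[OF _ a_e, of "f - a 1" 1] f_a[of 1] by simp
  have "vanishes_below (of_nat (Suc n) * e) (F f - f)" for n
  proof -
    have "vanishes_below (of_nat (Suc n) * e) (F f - a (Suc n))"
      using contr[OF f_e a_e f_a[of n]] by (simp add: a_Suc algebra_simps)
    from vanishes_below_diff[OF this f_a] show ?thesis by simp
  qed
  moreover have "of_nat n * e \<le> of_nat (Suc n) * e" for n using e by simp
  ultimately have "vanishes_below (of_nat n * e) (F f - f)" for n
    using vanishes_below_mono by blast
  then have "gcoeff (F f - f) q = 0" for q
    using N[of q] unfolding vanishes_below_def by blast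
  then have "F f = f" by (intro gen_series_eqI) simp
  with f_e show thesis by (rule that)
qed

text \<open>Here \<open>b = 1 + d\<close> is a square root of \<open>1 - a * a\<close>: the equation
  becomes \<open>d = - (a * a + d * d) / 2\<close>, a contraction because
  \<open>f * f - g * g = (f - g) * (f + g)\<close> and \<open>f + g\<close> vanishes below
  \<open>e\<close>.\<close>

lemma exists_pythagorean:
  assumes e: "0 < e" and a: "vanishes_below e a"
  obtains b where "a * a + b * b = 1"
proof -
  define F where "F d = (- 1/2) *\<^sub>R (a * a + d * d)" for d
  have sq: "vanishes_below e (d * d)" if "vanishes_below e d" for d
    using vanishes_below_mono[OF vanishes_below_times[OF that that]] e by simp
  obtain d where d: "F d = d"
  proof (rule gen_series_fixpoint[OF e, of F])
    show "vanishes_below e (F d)" if "vanishes_below e d" for d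
      unfolding F_def by (intro vanishes_below_scaleR vanishes_below_add sq that a)
    show "vanishes_below (t + e) (F f - F g)"
      if "vanishes_below e f" "vanishes_below e g" "vanishes_below t (f - g)" for f g t
    proof -
      have "F f - F g = (- 1/2) *\<^sub>R ((f - g) * (f + g))"
        by (simp add: F_def algebra_simps)
      then show ?thesis
        using that by (simp only: vanishes_below_scaleR vanishes_below_times vanishes_below_add)
    qed
  qed
  have "a * a + d * d = (- 2) *\<^sub>R F d" by (simp add: F_def)
  also have "\<dots> = - (d + d)" unfolding d by (simp add: scaleR_2)
  finally have "a * a + d * d + (d + d) = 0" by simp
  then have "a * a + (1 + d) * (1 + d) = 1" by (simp add: ring_distribs ac_simps)
  then show thesis by (rule that)
qed

text \<open>The series \<open>d\<close> is \<open>a / (1 - a)\<close>, obtained as a fixed point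
  without inverting anything.\<close>

lemma exists_geometric_series:
  assumes e: "0 < e" and a: "vanishes_below e a"
  obtains d where "vanishes_below e d" "a + a * d = d"
proof (rule gen_series_fixpoint[OF e, of "\<lambda>d. a + a * d"])
  show "vanishes_below e (a + a * d)" if "vanishes_below e d" for d
    using vanishes_below_mono[OF vanishes_below_times[OF a that]] e a by (simp add: vanishes_below_add)
  show "vanishes_below (t + e) (a + a * f - (a + a * g))" if "vanishes_below t (f - g)" for f g t
    using vanishes_below_times[OF a that] by (simp add: algebra_simps)
qed

text \<open>Dividing by the monomial of least index leaves a constant and a remainder
  \<open>m\<close> with positive support; well-ordering keeps that support away from 0, which gives
  \<open>e\<close>.\<close>

lemma gen_series_leading_term:
  assumes "f \<noteq> 0"
  obtains c q e m where "c \<noteq> 0" "gcoeff f q \<noteq> 0" "\<And>p. p < q \<Longrightarrow> gcoeff f p = 0" "0 < e" "vanishes_below e m"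
    "f = gmonom q * (of_real c + m)"
proof -
  have "gsupp f \<noteq> {}" using assms gen_series_eqI[of f 0] by auto
  then obtain q where q: "gcoeff f q \<noteq> 0" "\<And>p. gcoeff f p \<noteq> 0 \<Longrightarrow> q \<le> p"
    using well_orderedE[OF well_ordered_gsupp[of f], of "gsupp f"] by auto
  define m where "m = gmonom (- q) * f - of_real (gcoeff f q)"
  have coeff_m: "gcoeff m p = (if p = 0 then 0 else gcoeff f (p + q))" for p
    by (simp add: m_def gcoeff_gmonom_times of_real_def gcoeff_one)
  have pos: "0 < p" if "gcoeff m p \<noteq> 0" for p
    using that q(2)[of "p + q"] by (auto simp: coeff_m split: if_splits)
  have "\<exists>e>0. vanishes_below e m"
  proof (cases "gsupp m = {}")
    case True
    then have "vanishes_below 1 m" by (simp add: vanishes_below_def)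
    then show ?thesis using zero_less_one by blast
  next
    case False
    then obtain e where "e \<in> gsupp m" "\<And>p. p \<in> gsupp m \<Longrightarrow> e \<le> p"
      using well_orderedE[OF well_ordered_gsupp[of m], of "gsupp m"] by blast
    then have "0 < e" "vanishes_below e m"
      using pos by (auto simp: vanishes_below_def not_le[symmetric])
    then show ?thesis by blast
  qed
  then obtain e where "0 < e" "vanishes_below e m" by blast
  moreover have "f = gmonom q * (of_real (gcoeff f q) + m)"
    using gmonom_inverse[of q] by (simp add: m_def flip: mult.assoc)
  moreover have "gcoeff f p = 0" if "p < q" for p using q(2)[of p] that by force
  ultimately show thesis using q(1) that by blast
qed

section \<open>Ordered groups and valuations\<close>

lemma group_add_strict_left_mono:
  "a < b \<Longrightarrow> c + a < c + (b :: 'g::linordered_group_add)"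
  by (simp add: group_add_left_mono order_less_le)

lemma group_add_strict_right_mono:
  "a < b \<Longrightarrow> a + c < b + (c :: 'g::linordered_group_add)"
  by (simp add: group_add_right_mono order_less_le)

lemma group_add_strict_mono:
  "a < b \<Longrightarrow> c < d \<Longrightarrow> a + c < b + (d :: 'g::linordered_group_add)"
  by (rule less_trans[OF group_add_strict_right_mono group_add_strict_left_mono])

lemma nat_multiple_strict_mono:
  "g < h \<Longrightarrow> 0 < n \<Longrightarrow> ((+) g ^^ n) 0 < ((+) h ^^ n) (0 :: 'g::linordered_group_add)"
proof (induction n)
  case (Suc n)
  then show ?case by (cases n) (auto intro: group_add_strict_mono)
qed simp

lemma nat_multiple_0: "((+) 0 ^^ n) 0 = (0 :: 'g::group_add)"
  by (induction n) auto

text \<open>Uniqueness of division: distinct elements are comparable, and strict monotonicity keeps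
  their positive multiples distinct, even without commutativity. Passing to
  \<open>\<bar>n\<bar>\<close> removes the sign.\<close>

lemma int_multiple_inj:
  fixes g h :: "'g::linordered_group_add"
  assumes "int_multiple n g = int_multiple n h" "n \<noteq> 0"
  shows "g = h"
proof -
  define k where "k = nat \<bar>n\<bar>"
  have "0 < k" "((+) g ^^ k) 0 = ((+) h ^^ k) 0"
    using assms by (auto simp: k_def int_multiple_def abs_if split: if_splits)
  then show ?thesis
    using nat_multiple_strict_mono[of g h k] nat_multiple_strict_mono[of h g k] by force
qed

lemma int_multiple_0_right: "int_multiple n 0 = (0 :: 'g::group_add)"
  by (simp add: int_multiple_def nat_multiple_0)

text \<open>An independent list \<open>[g, h]\<close> would have length 2 and push the supremum
  above 1.\<close>

lemma rational_rank_le_1_dependent: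
  assumes "rational_rank G \<le> 1" "g \<in> G" "h \<in> G"
  obtains m n where "int_multiple m g + int_multiple n h = 0" "m \<noteq> 0 \<or> n \<noteq> 0"
proof -
  have "\<not> int_independent [g, h]"
  proof
    assume "int_independent [g, h]"
    then have "enat (length [g, h]) \<le> rational_rank G"
      unfolding rational_rank_def using assms(2,3) by (intro SUP_upper) auto
    then have "enat 2 \<le> 1" using assms(1) by (simp add: numeral_2_eq_2)
    then show False by (simp add: one_enat_def)
  qed
  then obtain ns where ns: "length ns = 2" "sum_list (map2 int_multiple ns [g, h]) = 0"
      "\<exists>n\<in>set ns. n \<noteq> 0"
    unfolding int_independent_def by (metis length_Cons list.size(3) numeral_2_eq_2)
  then obtain m n where "ns = [m, n]"
    by (auto simp: numeral_2_eq_2 length_Suc_conv)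
  then show thesis using ns that by auto
qed

section \<open>Arithmetic with infinite values\<close>

lemma Val_less_iff [simp]: "Val a < Val b \<longleftrightarrow> a < b"
  by (simp add: less_with_infinity_def less_le_not_le)

lemma Val_less_Infty [simp]: "Val a < Infty"
  by (simp add: less_with_infinity_def)

lemma not_Infty_less [simp]: "\<not> Infty < a"
  by (cases a) (auto simp: less_with_infinity_def)

text \<open>Being below \<open>b\<close>, \<open>a\<close> is finite; an infinite \<open>c\<close>
  would absorb both sides.\<close>

lemma with_infinity_add_strict_left_mono:
  "a < b \<Longrightarrow> c \<noteq> Infty \<Longrightarrow> c + a < c + (b :: 'g::linordered_group_add with_infinity)"
  by (cases a; cases b; cases c) (auto intro: group_add_strict_left_mono)

lemma with_infinity_add_strict_right_mono:
  "a < b \<Longrightarrow> c \<noteq> Infty \<Longrightarrow> a + c < b + (c :: 'g::linordered_group_add with_infinity)"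
  by (cases a; cases b; cases c) (auto intro: group_add_strict_right_mono)

lemma with_infinity_double_neg:
  "a < 0 \<Longrightarrow> a + a < (0 :: 'g::linordered_group_add with_infinity)"
  using with_infinity_add_strict_left_mono[of a 0 a] by (cases a) (auto simp: zero_with_infinity_def dest: less_trans)

section \<open>Valuations with real residue field\<close>

locale real_valuation =
  fixes w :: "'d::real_div_algebra \<Rightarrow> 'g::linordered_group_add with_infinity"
  assumes valuation: "is_valuation w"
    and residue: "residue_field_is_real w"
begin

lemma val_Infty_iff: "w a = Infty \<longleftrightarrow> a = 0"
  and val_mult: "w (a * b) = w a + w b"
  and val_add: "min (w a) (w b) \<le> w (a + b)"
  and val_of_real: "r \<noteq> 0 \<Longrightarrow> w (of_real r) = 0"
  using valuation by (simp_all add: is_valuation_def)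

lemma val_zero [simp]: "w 0 = Infty"
  by (simp add: val_Infty_iff)

lemma val_one: "w 1 = 0"
  using val_of_real[of 1] by simp

lemma val_minus: "w (- a) = w a"
  using val_mult[of "of_real (- 1)" a] val_of_real[of "- 1"] by simp

lemma val_add_greater: "g < w a \<Longrightarrow> g < w b \<Longrightarrow> g < w (a + b)"
  using val_add[of a b] by (simp add: min_def split: if_splits)

lemma val_diff_greater: "g < w a \<Longrightarrow> g < w b \<Longrightarrow> g < w (a - b)"
  using val_add_greater[of g a "- b"] by (simp add: val_minus)

text \<open>Were the value of \<open>a + b\<close> larger, then \<open>a\<close>, the difference of
  \<open>a + b\<close> and \<open>b\<close>, would have a value larger than its own.\<close>

lemma val_add_eq:
  assumes "w a < w b" shows "w (a + b) = w a"
proof (rule antisym)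
  show "w a \<le> w (a + b)" using val_add[of a b] assms by (simp add: min_absorb1)
  show "w (a + b) \<le> w a"
    using val_diff_greater[of "w a" "a + b" b] assms by (auto simp: not_less[symmetric])
qed

text \<open>By surjectivity of the residue map the coset of \<open>d\<close> is that of a real
  \<open>r\<close>; as \<open>d\<close> lies in its own coset, \<open>d - of_real r\<close> is in
  the ideal.\<close>

lemma residue_real:
  assumes "0 \<le> w d"
  obtains r where "0 < w (d - of_real r)"
proof -
  let ?I = "valuation_ideal w" and ?O = "valuation_ring w"
  have "bij_betw (\<lambda>r. ?I +>\<^bsub>?O\<^esub> of_real r) (carrier real_ring) (carrier (residue_ring w))"
    using residue by (simp add: residue_field_is_real_def ring_iso_def)
  moreover have "?I +>\<^bsub>?O\<^esub> d \<in> carrier (residue_ring w)"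
    using assms by (auto simp: residue_ring_def FactRing_def A_RCOSETS_def' valuation_ring_def)
  ultimately obtain r where "?I +>\<^bsub>?O\<^esub> d = ?I +>\<^bsub>?O\<^esub> of_real r"
    by (auto simp: bij_betw_def image_iff)
  moreover have "d \<in> ?I +>\<^bsub>?O\<^esub> d"
    by (auto simp: a_r_coset_def' valuation_ring_def valuation_ideal_def val_zero
        zero_with_infinity_def intro!: bexI[of _ 0])
  ultimately have "d \<in> ?I +>\<^bsub>?O\<^esub> of_real r" by simp
  then have "0 < w (d - of_real r)"
    by (auto simp: a_r_coset_def' valuation_ring_def valuation_ideal_def)
  then show thesis by (rule that)
qed

text \<open>Here \<open>r\<close> is the residue of \<open>b * inverse a\<close>; multiplying back
  by \<open>a\<close> on the right respects noncommutativity.\<close>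

lemma val_leading_coefficient:
  assumes "a \<noteq> 0" "w b = w a"
  obtains r where "w a < w (b - of_real r * a)"
proof -
  have a: "w a \<noteq> Infty" "w (inverse a) + w a = 0"
    using assms(1) by (simp_all add: val_Infty_iff val_one flip: val_mult)
  have "w (b * inverse a) = w (a * inverse a)" by (simp only: val_mult assms(2))
  then have "0 \<le> w (b * inverse a)" using assms(1) by (simp add: val_one)
  then obtain r where "0 < w (b * inverse a - of_real r)" by (rule residue_real)
  from with_infinity_add_strict_right_mono[OF this a(1)]
  have "w a < w ((b * inverse a - of_real r) * a)" by (simp add: val_mult)
  also have "(b * inverse a - of_real r) * a = b - of_real r * a"
    using assms(1) by (simp add: algebra_simps)
  finally show thesis by (rule that)
qed

end

section \<open>Valuations on extensions of the field of generalized power series\<close>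

locale gen_series_valuation = real_valuation w
  for w :: "'d::real_div_algebra \<Rightarrow> 'g::linordered_group_add with_infinity" +
  fixes \<phi> :: "gen_series \<Rightarrow> 'd"
  assumes hom_add: "\<phi> (f + g) = \<phi> f + \<phi> g"
    and hom_mult: "\<phi> (f * g) = \<phi> f * \<phi> g"
    and hom_of_real: "\<phi> (of_real r) = of_real r"
begin

lemma hom_0: "\<phi> 0 = 0" and hom_1: "\<phi> 1 = 1"
  using hom_of_real[of 0] hom_of_real[of 1] by simp_all

lemma hom_diff: "\<phi> (f - g) = \<phi> f - \<phi> g"
  using hom_add[of "f - g" g] by simp

lemma hom_gmonom_inverse: "\<phi> (gmonom q) * \<phi> (gmonom (- q)) = 1"
  by (simp add: gmonom_inverse hom_1 flip: hom_mult)

lemma hom_gmonom_nonzero: "\<phi> (gmonom q) \<noteq> 0"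
  using hom_gmonom_inverse[of q] by auto

text \<open>A series \<open>a\<close> of negative value with infinitesimal terms would be a leg of a right triangle
  with hypotenuse \<open>1\<close>, although no cancellation occurs in a sum of squares over a
  formally real residue field.\<close>

lemma val_nonneg:
  assumes e: "0 < e" and a: "vanishes_below e a"
  shows "0 \<le> w (\<phi> a)"
proof (rule ccontr)
  assume "\<not> 0 \<le> w (\<phi> a)"
  then have neg: "w (\<phi> a) < 0" by simp
  then have a0: "\<phi> a \<noteq> 0" by (metis not_Infty_less val_Infty_iff)
  then have fin: "w (\<phi> a) \<noteq> Infty" by (simp add: val_Infty_iff)
  from neg have neg2: "w (\<phi> a * \<phi> a) < 0"
    unfolding val_mult by (rule with_infinity_double_neg)
  obtain b where b: "a * a + b * b = 1" using exists_pythagorean[OF e a] .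
  have "\<phi> a * \<phi> a + \<phi> b * \<phi> b = 1"
    using arg_cong[OF b, of \<phi>] by (simp add: hom_add hom_mult hom_1)
  then have "\<phi> b * \<phi> b = - (\<phi> a * \<phi> a) + 1" by (simp add: algebra_simps)
  moreover have "w (- (\<phi> a * \<phi> a) + 1) = w (- (\<phi> a * \<phi> a))"
    using neg2 by (intro val_add_eq) (simp add: val_one val_minus)
  ultimately have eq2: "w (\<phi> b) + w (\<phi> b) = w (\<phi> a) + w (\<phi> a)"
    by (simp add: val_minus flip: val_mult)
  \<comment> \<open>Doubling is strictly increasing on an ordered group, so equal doubles force
    equal values.\<close>
  have "w (\<phi> b) = w (\<phi> a)"
  proof (cases "w (\<phi> b)")
    case (Val h)
    obtain g where "w (\<phi> a) = Val g" using fin by (cases "w (\<phi> a)") auto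
    then show ?thesis
      using eq2 Val group_add_strict_mono[of g h g h] group_add_strict_mono[of h g h g] by force
  next
    case Infty
    then show ?thesis using eq2 by (cases "w (\<phi> a)") auto
  qed
  with a0 obtain r where r: "w (\<phi> a) < w (\<phi> b - of_real r * \<phi> a)"
    by (rule val_leading_coefficient)
  \<comment> \<open>Removing the leading part \<open>of_real r * a\<close> from \<open>b\<close>
    rewrites \<open>a * a + b * b\<close> as
    \<open>of_real (1 + r\<^sup>2) * (a * a) + c * s\<close>. Since \<open>1 + r\<^sup>2\<close> is
    nonzero for real \<open>r\<close>, the first term dominates, so 1 would have negative
    value.\<close>
  define c where "c = b - of_real r * a"
  have c: "w (\<phi> a) < w (\<phi> c)" using r by (simp add: c_def hom_diff hom_mult hom_of_real)
  define s where "s = of_real r * a + b"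
  have "1 = a * a + b * b" using b by simp
  also have "\<dots> = of_real (1 + r\<^sup>2) * (a * a) + c * s"
    by (simp add: c_def s_def algebra_simps power2_eq_square)
  finally have "\<phi> 1 = of_real (1 + r\<^sup>2) * (\<phi> a * \<phi> a) + \<phi> c * \<phi> s"
    by (metis hom_add hom_mult hom_of_real)
  moreover have "w (of_real (1 + r\<^sup>2) * (\<phi> a * \<phi> a)) = w (\<phi> a) + w (\<phi> a)"
    by (subst val_mult, subst val_of_real) (auto simp: val_mult add_nonneg_eq_0_iff)
  moreover have "w (\<phi> a) + w (\<phi> a) < w (\<phi> c * \<phi> s)"
  proof -
    have ra: "w (\<phi> a) \<le> w (of_real r * \<phi> a)"
      by (cases "r = 0"; cases "w (\<phi> a)") (simp_all add: val_mult val_of_real)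
    have "w (\<phi> a) \<le> w (\<phi> s)"
      using val_add[of "of_real r * \<phi> a" "\<phi> b"] ra \<open>w (\<phi> b) = w (\<phi> a)\<close>
      by (simp add: s_def hom_add hom_mult hom_of_real min_def split: if_splits)
    then have "w (\<phi> a) + w (\<phi> a) \<le> w (\<phi> a) + w (\<phi> s)"
      using with_infinity_add_strict_left_mono[OF _ fin, of "w (\<phi> a)" "w (\<phi> s)"]
      by (auto simp: le_less)
    \<comment> \<open>Strictness requires a finite value of \<open>\<phi> s\<close>; if
      \<open>\<phi> s = 0\<close>, the product has value \<open>Infty\<close> and finiteness of
      \<open>w (\<phi> a)\<close> suffices.\<close>
    also have "w (\<phi> a) + w (\<phi> s) < w (\<phi> c * \<phi> s)" if "\<phi> s \<noteq> 0"
      unfolding val_mult using that c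
      by (intro with_infinity_add_strict_right_mono) (auto simp: val_Infty_iff)
    finally show ?thesis
      using fin by (cases "\<phi> s = 0"; cases "w (\<phi> a)") auto
  qed
  ultimately have "w (\<phi> 1) = w (\<phi> a) + w (\<phi> a)" by (simp add: val_add_eq)
  then show False using neg2 by (simp add: hom_1 val_one val_mult)
qed

text \<open>If the residue \<open>r\<close> were nonzero, \<open>b = a / r\<close> would have
  residue 1, so \<open>b - 1\<close> would have positive value and \<open>b\<close> value 0. Then
  \<open>d = b / (1 - b)\<close> has negative value although it vanishes below \<open>e\<close>,
  against \<open>val_nonneg\<close>.\<close>

lemma val_pos:
  assumes e: "0 < e" and a: "vanishes_below e a"
  shows "0 < w (\<phi> a)"
proof -
  obtain r where r: "0 < w (\<phi> a - of_real r)"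
    using residue_real[OF val_nonneg[OF e a]] .
  show ?thesis
  proof (cases "r = 0")
    case False
    define b where "b = (1 / r) *\<^sub>R a"
    have b: "vanishes_below e b" unfolding b_def using a by (rule vanishes_below_scaleR)
    have "of_real r * b = a" using False by (simp add: b_def of_real_def)
    then have "\<phi> a - of_real r = of_real r * (\<phi> b - 1)"
      by (metis hom_mult hom_of_real mult.right_neutral right_diff_distrib)
    then have gt: "0 < w (\<phi> b - 1)" using r False by (simp add: val_mult val_of_real)
    have b1: "w (\<phi> b) = 0"
      using val_add_eq[of 1 "\<phi> b - 1"] gt by (simp add: val_one)
    obtain d where d: "vanishes_below e d" "b + b * d = d"
      using exists_geometric_series[OF e b] .
    have "\<phi> d = \<phi> b + \<phi> b * \<phi> d" using arg_cong[OF d(2), of \<phi>] by (simp add: hom_add hom_mult)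
    then have "(\<phi> b - 1) * \<phi> d = - \<phi> b" by (simp add: algebra_simps)
    then have sum0: "w (\<phi> b - 1) + w (\<phi> d) = 0" by (metis b1 val_minus val_mult)
    then have "w (\<phi> d) \<noteq> Infty" by (auto simp: zero_with_infinity_def)
    from with_infinity_add_strict_right_mono[OF gt this]
    have "w (\<phi> d) < 0" by (simp add: sum0)
    then show ?thesis using val_nonneg[OF e d(1)] by simp
  qed (use r in simp)
qed

section \<open>Monomials and the order valuation\<close>

lemma val_gmonom_pos:
  assumes "0 < q" shows "0 < w (\<phi> (gmonom q))"
  using val_pos[OF assms, of "gmonom q"] by (simp add: vanishes_below_def gcoeff_gmonom)

lemma val_gmonom_strict_mono:
  assumes "p < q" shows "w (\<phi> (gmonom p)) < w (\<phi> (gmonom q))"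
proof -
  have "gmonom q = gmonom p * gmonom (q - p)" by (simp flip: gmonom_add)
  then have "w (\<phi> (gmonom q)) = w (\<phi> (gmonom p)) + w (\<phi> (gmonom (q - p)))"
    by (simp add: hom_mult val_mult)
  then show ?thesis
    using with_infinity_add_strict_left_mono[OF val_gmonom_pos[of "q - p"], of "w (\<phi> (gmonom p))"] assms
    by (simp add: val_Infty_iff hom_gmonom_nonzero)
qed

lemma val_gmonom_mono: "p \<le> q \<Longrightarrow> w (\<phi> (gmonom p)) \<le> w (\<phi> (gmonom q))"
  using val_gmonom_strict_mono[of p q] by (cases "p = q") auto

text \<open>The factor \<open>of_real c + m\<close> left after splitting off the leading monomial
  has value 0, because \<open>val_pos\<close> makes \<open>m\<close> negligible.\<close>

lemma val_leading_exponent: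
  assumes "f \<noteq> 0"
  obtains q where "gcoeff f q \<noteq> 0" "\<And>p. p < q \<Longrightarrow> gcoeff f p = 0"
    "w (\<phi> f) = w (\<phi> (gmonom q))"
proof -
  obtain c q e m where *: "c \<noteq> 0" "gcoeff f q \<noteq> 0" "\<And>p. p < q \<Longrightarrow> gcoeff f p = 0"
    "0 < e" "vanishes_below e m" "f = gmonom q * (of_real c + m)" 
    by (rule gen_series_leading_term[OF assms]) blast
  have "w (of_real c + \<phi> m) = 0"
    using val_pos[OF *(4,5)] *(1) val_add_eq[of "of_real c" "\<phi> m"] by (simp add: val_of_real)
  then have "w (\<phi> f) = w (\<phi> (gmonom q))"
    unfolding *(6) by (simp add: hom_mult hom_add hom_of_real val_mult)
  with *(2,3) show thesis by (rule that)
qed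

text \<open>This translates closeness under \<open>w\<close> into agreement of coefficients, the
  bridge needed for gluing approximations.\<close>

lemma val_greater_gmonom_iff:
  "w (\<phi> (gmonom q)) < w (\<phi> f) \<longleftrightarrow> (\<forall>p\<le>q. gcoeff f p = 0)"
proof (cases "f = 0")
  case True
  then show ?thesis
    using hom_gmonom_nonzero[of q]
    by (cases "w (\<phi> (gmonom q))") (auto simp: hom_0 val_Infty_iff)
next
  case False
  then obtain p where p: "gcoeff f p \<noteq> 0" "\<And>r. r < p \<Longrightarrow> gcoeff f r = 0"
    "w (\<phi> f) = w (\<phi> (gmonom p))" by (rule val_leading_exponent) blast
  have "w (\<phi> (gmonom q)) < w (\<phi> (gmonom p)) \<longleftrightarrow> q < p"
    by (metis less_asym less_irrefl linorder_neqE val_gmonom_strict_mono)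
  also have "\<dots> \<longleftrightarrow> (\<forall>r\<le>q. gcoeff f r = 0)"
    using p(1,2) by (meson le_less_trans not_le)
  finally show ?thesis using p(3) by simp
qed

section \<open>Divisibility and rational rank one\<close>

lemma val_gmonom_nat_multiple:
  assumes "w (\<phi> (gmonom q)) = Val h"
  shows "w (\<phi> (gmonom (of_nat n * q))) = Val (((+) h ^^ n) 0)"
proof (induction n)
  case 0
  then show ?case by (simp add: gmonom_0 hom_1 val_one zero_with_infinity_def)
next
  case (Suc n)
  have "gmonom (of_nat (Suc n) * q) = gmonom q * gmonom (of_nat n * q)"
    by (simp add: algebra_simps flip: gmonom_add)
  then show ?case using Suc assms by (simp add: hom_mult val_mult)
qed

lemma val_gmonom_uminus:
  assumes "w (\<phi> (gmonom q)) = Val h"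
  shows "w (\<phi> (gmonom (- q))) = Val (- h)"
proof -
  have "Val h + w (\<phi> (gmonom (- q))) = Val 0"
    using arg_cong[OF hom_gmonom_inverse[of q], of w] assms
    by (simp add: val_mult val_one zero_with_infinity_def)
  then show ?thesis
    by (cases "w (\<phi> (gmonom (- q)))") (auto simp: minus_unique)
qed

lemma val_gmonom_int_multiple:
  assumes "w (\<phi> (gmonom q)) = Val h"
  shows "w (\<phi> (gmonom (of_int n * q))) = Val (int_multiple n h)"
proof (cases "0 \<le> n")
  case True
  then show ?thesis
    using val_gmonom_nat_multiple[OF assms, of "nat n"] by (simp add: int_multiple_def)
next
  case False
  then have "of_int n * q = - (of_nat (nat (- n)) * q)" by simp
  then show ?thesis
    using val_gmonom_uminus[OF val_gmonom_nat_multiple[OF assms, of "nat (- n)"]] False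
    by (simp only: int_multiple_def if_False)
qed

text \<open>The values of the monomials form a divisible subgroup, so in rational rank one they exhaust
  the value group.\<close>

lemma val_eq_val_gmonom:
  assumes rank: "rational_rank (value_group w) \<le> 1" and d: "d \<noteq> 0"
  obtains q where "w d = w (\<phi> (gmonom q))"
proof -
  obtain g where g: "w d = Val g" using d val_Infty_iff[of d] by (cases "w d") auto
  have ex: "\<exists>h. w (\<phi> (gmonom q)) = Val h" for q
    using hom_gmonom_nonzero val_Infty_iff by (cases "w (\<phi> (gmonom q))") auto
  obtain h where h: "w (\<phi> (gmonom 1)) = Val h" using ex by blast
  have "0 < h" using val_gmonom_pos[of 1] h by (simp add: zero_with_infinity_def)
  have "g \<in> value_group w" "h \<in> value_group w"
    using d g h hom_gmonom_nonzero by (auto simp: value_group_def)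
  then obtain m n where mn: "int_multiple m g + int_multiple n h = 0" "m \<noteq> 0 \<or> n \<noteq> 0"
    by (rule rational_rank_le_1_dependent[OF rank])
  \<comment> \<open>Otherwise a nonzero multiple of the positive element \<open>h\<close> would
    vanish.\<close>
  have "m \<noteq> 0"
  proof
    assume "m = 0"
    with mn have "int_multiple n h = int_multiple n 0" "n \<noteq> 0"
      by (simp_all add: int_multiple_0_right) (simp_all add: int_multiple_def)
    then show False using int_multiple_inj \<open>0 < h\<close> by blast
  qed
  \<comment> \<open>Division in the rationals solves \<open>m * q = - n\<close>, so the value
    \<open>k\<close> of \<open>gmonom q\<close> has the same multiple by \<open>m\<close> as
    \<open>g\<close>; uniqueness of division gives \<open>k = g\<close>.\<close>
  define q where "q = - of_int n / (of_int m :: rat)"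
  obtain k where k: "w (\<phi> (gmonom q)) = Val k" using ex by blast
  have "of_int m * q = - (of_int n * 1)" using \<open>m \<noteq> 0\<close> by (simp add: q_def)
  then have "Val (int_multiple m k) = Val (- int_multiple n h)"
    using val_gmonom_int_multiple[OF k, of m] val_gmonom_uminus[OF val_gmonom_int_multiple[OF h, of n]]
    by simp
  also have "- int_multiple n h = int_multiple m g" using mn(1) by (simp add: add_eq_0_iff2)
  finally have "k = g" using int_multiple_inj \<open>m \<noteq> 0\<close> by auto
  then show thesis using that[of q] g k by simp
qed

text \<open>If \<open>d\<close> were not a series, gluing approximations to \<open>d\<close> would give a series \<open>A\<close> at least as
  good as all of them; but the leading term of \<open>d - A\<close> improves \<open>A\<close>.\<close>

lemma hom_surj_of_rank_le_1:
  assumes rank: "rational_rank (value_group w) \<le> 1"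
  shows "d \<in> range \<phi>"
proof (rule ccontr)
  assume d: "d \<notin> range \<phi>"
  \<comment> \<open>The exponents beyond which some series approximates \<open>d\<close>; this set
    is closed downwards.\<close>
  define S where "S = {q. \<exists>f. w (\<phi> (gmonom q)) < w (d - \<phi> f)}"
  obtain a where a: "\<And>q. q \<in> S \<Longrightarrow> w (\<phi> (gmonom q)) < w (d - \<phi> (a q))"
  proof -
    have "\<forall>q\<in>S. \<exists>f. w (\<phi> (gmonom q)) < w (d - \<phi> f)" by (simp add: S_def)
    then show thesis using that by (metis bchoice)
  qed
  define c where "c q = (if q \<in> S then gcoeff (a q) q else 0)" for q
  have S_down: "p \<in> S" if "q \<in> S" "p \<le> q" for p q
    using that val_gmonom_mono[of p q] unfolding S_def by (auto intro: le_less_trans)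
  have c: "gcoeff (a q) p = c p" if "q \<in> S" "p \<le> q" for p q
  proof -
    have "w (\<phi> (gmonom p)) < w (d - \<phi> (a q))"
      using val_gmonom_mono[OF that(2)] a[OF that(1)] by (rule le_less_trans)
    \<comment> \<open>Both \<open>a p\<close> and \<open>a q\<close> approximate \<open>d\<close>
      beyond \<open>p\<close>, so they differ by a series of value beyond \<open>p\<close> and share
      the coefficient there.\<close>
    then have "w (\<phi> (gmonom p)) < w ((d - \<phi> (a p)) - (d - \<phi> (a q)))"
      using a[OF S_down[OF that]] by (rule val_diff_greater[rotated])
    then have "w (\<phi> (gmonom p)) < w (\<phi> (a q - a p))" by (simp add: hom_diff)
    then show ?thesis using S_down[OF that] by (auto simp: val_greater_gmonom_iff c_def)
  qed
  have "\<exists>f. \<forall>p\<le>q. gcoeff f p = c p" if "c q \<noteq> 0" for q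
  proof -
    have "q \<in> S" using that by (simp add: c_def split: if_splits)
    then show ?thesis using c by blast
  qed
  from gen_series_glue[of c, OF this] obtain A where A: "\<And>q. gcoeff A q = c q" by blast
  have best: "w (\<phi> (gmonom q)) < w (d - \<phi> A)" if "q \<in> S" for q
  proof -
    have "w (\<phi> (gmonom q)) < w (\<phi> (a q - A))"
      using c[OF that] by (simp add: val_greater_gmonom_iff A)
    from val_add_greater[OF a[OF that] this] show ?thesis by (simp add: hom_diff)
  qed
  have "d - \<phi> A \<noteq> 0" using d by auto
  then obtain q where q: "w (d - \<phi> A) = w (\<phi> (gmonom q))" by (rule val_eq_val_gmonom[OF rank])
  obtain r where "w (\<phi> (gmonom q)) < w (d - \<phi> A - of_real r * \<phi> (gmonom q))"
    using val_leading_coefficient[OF hom_gmonom_nonzero q] .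
  then have "w (\<phi> (gmonom q)) < w (d - \<phi> (A + of_real r * gmonom q))"
    by (simp add: hom_add hom_mult hom_of_real diff_diff_eq)
  then have "q \<in> S" unfolding S_def by blast
  from best[OF this] show False using q by simp
qed

end

theorem proposition5p2:
  fixes v :: "gen_series skew_poly \<Rightarrow> 'g::linordered_group_add with_infinity"
    and \<iota> :: "gen_series skew_poly \<Rightarrow> 'd::real_div_algebra"
    and w :: "'d \<Rightarrow> 'g with_infinity"
  assumes "is_valuation v"
    and "is_quotient_division_ring \<iota>"
    and "is_valuation w" and "\<And>a. w (\<iota> a) = v a"
    and "residue_field_is_real w"
  shows "rational_rank (value_group w) \<noteq> 1"
proof
  assume rank: "rational_rank (value_group w) = 1"
  have \<iota>: "inj \<iota>" "\<And>a b. \<iota> (a + b) = \<iota> a + \<iota> b" "\<And>a b. \<iota> (a * b) = \<iota> a * \<iota> b"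
    "\<And>r. \<iota> (of_real r) = of_real r"
    using assms(2) by (simp_all add: is_quotient_division_ring_def)
  \<comment> \<open>The constants are viewed inside the quotient division ring, where leading
    coefficients can be formed by division.\<close>
  interpret gen_series_valuation w "\<lambda>f. \<iota> (skew_const f)"
    using assms(3,5) by unfold_locales (simp_all add: \<iota> skew_const_add skew_const_mult skew_const_of_real)
  obtain f where "\<iota> skew_y = \<iota> (skew_const f)"
    using hom_surj_of_rank_le_1[of "\<iota> skew_y"] rank by auto
  then have "skew_y = skew_const f" by (rule injD[OF \<iota>(1)])
  \<comment> \<open>The representing polynomial \<open>[:0, 1:]\<close> has degree one, unlike a
    constant.\<close>
  then show False by transfer simp
qed

end
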